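(* There exist constants $d_k$ ($k = 0,1,2,\dots$) such that the following hold. (i) Uniformly in integers $k \ge 0$, $$\sum_{n\le x,\; B(n)-\beta(n)=k} 1 \;=\; d_k x + O\left(x^{1/2}\log x\right).$$ (ii) Uniformly in integers $k \ge 1$, $$\sum_{n\le x,\; B(n)-\beta(n)\ge k} 1 \;\ll\; \frac{x}{k}.$$ (iii) For any given real $r > 0$, $$\mathop{{\sum}'}_{n\le x} \frac{1}{(B(n)-\beta(n))^r} \;=\; D_r x + O\left(x^{1-\frac{r}{2}}\log x\right) + O\left(x^{1/2}\log x\right),$$ where $\sum'$ denotes summation over those positive integers $n \le x$ which are not squarefree, and $$D_r = \sum_{k=1}^\infty \frac{d_k}{k^r}.$$
   Context: For a positive integer $n$, define the additive functions $$\beta(n) = \sum_{p\mid n} p, \qquad B(n) = \sum_{p^\alpha \| n} \alpha p,$$ where $p$ denotes primes and $p^\alpha \| n$ means that $p^\alpha$ divides $n$ but $p^{\alpha+1}$ does not (with $\beta(1)=B(1)=0$). Thus $B(n)-\beta(n)=\sum_{p^\alpha\| n}(\alpha-1)p$ is a nonnegative integer, equal to $0$ exactly when $n$ is squarefree. Sums over $n\le x$ run over positive integers $n$. The estimates are for real $x \ge 2$. "Uniformly in $k$" means that the implied constants do not depend on $k$ (nor on $x$); in (iii) the implied constants may depend on the fixed $r$. The constant $d_k$ is the local density $d_k = \lim_{x\to\infty} \frac1x \#\{n\le x : B(n)-\beta(n)=k\}$, and the same constants $d_k$ appear in (i) and in the definition of $D_r$ in (iii). *)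

theory Defs
  imports Complex_Main
    "HOL-Computational_Algebra.Primes"
    "HOL-Computational_Algebra.Squarefree"
begin

definition beta_add :: "nat \<Rightarrow> nat" where
  "beta_add n = (\<Sum>p\<in>prime_factors n. p)"

definition B_add :: "nat \<Rightarrow> nat" where
  "B_add n = (\<Sum>p\<in>prime_factors n. multiplicity p n * p)"

text \<open>Hence the natural-number subtraction \<open>B_add n - beta_add n\<close> never truncates.\<close>

lemma beta_add_le_B_add: "beta_add n \<le> B_add n"
  unfolding beta_add_def B_add_def
proof (rule sum_mono)
  fix p assume "p \<in> prime_factors n"
  hence "1 \<le> multiplicity p n"
    by (simp add: prime_factors_multiplicity Suc_le_eq)
  thus "p \<le> multiplicity p n * p"
    by simp
qed

end

theory Submission
  imports Defs "HOL-Analysis.Harmonic_Numbers" "HOL-Real_Asymp.Real_Asymp"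
begin

text \<open>
  Write \<open>f n = B n - \<beta> n\<close>. Multiplying \<open>n\<close> by a prime that does not divide it leaves \<open>f n\<close>
  unchanged, so every function \<open>h = H \<circ> f\<close> depends only on the powerful part of its argument.
  Consequently the convolution \<open>g = \<mu> * h\<close> with the Moebius function vanishes off the powerful
  numbers (\<open>sieve_transform_eq_0\<close>), and if \<open>H\<close> is bounded by \<open>1\<close> then \<open>\<bar>g n\<bar>\<close> is at most the
  number of squarefree divisors of \<open>n\<close> (\<open>abs_sieve_transform_le\<close>), a bound independent of \<open>H\<close>.

  Powerful numbers have the form \<open>a\<^sup>2 b\<^sup>3\<close>. Counting them with their squarefree divisors amounts
  to counting solutions of \<open>(a1 a2)\<^sup>2 (b1 b2)\<^sup>3 \<le> N\<close>, of which there are \<open>O(sqrt N log N)\<close>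
  (\<open>sum_weight_bound\<close>); dyadically, the tail of the same count weighted by \<open>1 / n\<close> is
  \<open>O(log N / sqrt N)\<close> (\<open>weight_tail_bound\<close>). Since the sum of \<open>h\<close> up to \<open>N\<close> equals the sum of
  \<open>g d (N div d)\<close>, it follows that the sum of \<open>H (f n)\<close> over \<open>n \<le> x\<close> is
  \<open>M x + O(sqrt x log x)\<close> with an absolute implied constant (\<open>blind_mean_value\<close>).

  Part (i) is the case where \<open>H\<close> is the indicator of \<open>k\<close>, and the asymptotic formula of part (iii)
  is the case \<open>H j = 1 / j powr r\<close>. For part (ii), \<open>f n\<close> is at most twice the largest \<open>m\<close> with
  \<open>m\<^sup>2\<close> dividing \<open>n\<close> (\<open>excess_le_square_part\<close>), so \<open>f n \<ge> k\<close> forces a divisor \<open>m\<^sup>2\<close> with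
  \<open>m \<ge> k / 2\<close>, which few \<open>n\<close> have. Part (ii) also supplies the tail bound that identifies the
  mean value in part (iii) with the series \<open>D\<^sub>r\<close>.
\<close>

section \<open>Sums over squarefree divisors\<close>

definition sqfree_divisors :: "nat \<Rightarrow> nat set" where
  "sqfree_divisors n = {e. e dvd n \<and> squarefree e}"

text \<open>
  On squarefree arguments this is the Moebius function. Other arguments never occur, since the
  sums below run over \<open>sqfree_divisors\<close>.
\<close>

definition parity_sign :: "nat \<Rightarrow> real" where
  "parity_sign e = (-1) ^ card (prime_factors e)"

lemma finite_sqfree_divisors: "n > 0 \<Longrightarrow> finite (sqfree_divisors n)"
  unfolding sqfree_divisors_def by (rule finite_subset[of _ "{d. d dvd n}"]) auto

lemma parity_sign_mult_prime:
  assumes "prime p" "\<not> p dvd e" "e > 0"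
  shows "parity_sign (p * e) = - parity_sign e"
proof -
  have "prime_factors (p * e) = insert p (prime_factors e)"
    using assms by (subst prime_factors_product) (auto simp: prime_prime_factors)
  moreover have "p \<notin> prime_factors e" using assms by auto
  ultimately show ?thesis by (simp add: parity_sign_def)
qed

lemma squarefree_mult_prime:
  fixes p e :: nat
  assumes "prime p" "\<not> p dvd e" "squarefree e"
  shows "squarefree (p * e)"
  using assms squarefree_mult_coprime[of p e] squarefree_prime[of p] prime_imp_coprime[of p e] by auto

text \<open>
  The squarefree divisors of \<open>n\<close> come in pairs \<open>e\<close>, \<open>p e\<close> of opposite sign, so a weight
  \<open>F\<close> that does not separate the two members of a pair sums to zero. Constant \<open>F\<close> gives the
  basic identity of the Moebius function; the choice \<open>F e = h (n / e)\<close> shows later that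
  \<open>sieve_transform h\<close> lives on powerful numbers.
\<close>

lemma sqfree_divisors_sum_cancel:
  assumes p: "prime p" "p dvd n" and n: "n > 0"
    and F: "\<And>e. p * e dvd n \<Longrightarrow> \<not> p dvd e \<Longrightarrow> F (p * e) = F e"
  shows "(\<Sum>e\<in>sqfree_divisors n. parity_sign e * F e) = (0::real)"
proof -
  define A where "A = {e\<in>sqfree_divisors n. \<not> p dvd e}"
  have finA: "finite A" using finite_sqfree_divisors[OF n] by (simp add: A_def)
  have pA: "p * e dvd n" if "e \<in> A" for e
    using that p by (intro divides_mult) (auto simp: A_def sqfree_divisors_def prime_imp_coprime)
  have split: "sqfree_divisors n = A \<union> (\<lambda>e. p * e) ` A"
  proof (intro equalityI subsetI)
    fix e assume e: "e \<in> sqfree_divisors n"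
    show "e \<in> A \<union> (\<lambda>e. p * e) ` A"
    proof (cases "p dvd e")
      case True
      then obtain d where d: "e = p * d" by auto
      have "\<not> p dvd d"
      proof
        assume "p dvd d"
        hence "p ^ 2 dvd e" unfolding d power2_eq_square by (rule mult_dvd_mono[OF dvd_refl])
        hence "p dvd 1" using e unfolding sqfree_divisors_def by (blast dest: squarefreeD)
        thus False using p by simp
      qed
      moreover have "squarefree d" using e d
        by (auto simp: sqfree_divisors_def intro: squarefree_mono[of d e])
      moreover have "d dvd n" using e d by (auto simp: sqfree_divisors_def dest: dvd_mult_right)
      ultimately show ?thesis by (auto simp: A_def sqfree_divisors_def d)
    qed (use e in \<open>auto simp: A_def\<close>)
  next
    fix e assume "e \<in> A \<union> (\<lambda>e. p * e) ` A"
    thus "e \<in> sqfree_divisors n"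
    proof
      assume "e \<in> (\<lambda>e. p * e) ` A"
      then obtain d where d: "d \<in> A" "e = p * d" by auto
      thus ?thesis using pA[OF d(1)] p squarefree_mult_prime[of p d]
        by (auto simp: A_def sqfree_divisors_def)
    qed (simp add: A_def)
  qed
  have inj: "inj_on (\<lambda>e. p * e) A" using p by (auto simp: inj_on_def prime_gt_0_nat)
  have "(\<Sum>e\<in>sqfree_divisors n. parity_sign e * F e)
      = (\<Sum>e\<in>A. parity_sign e * F e) + (\<Sum>e\<in>(\<lambda>e. p * e) ` A. parity_sign e * F e)"
    unfolding split by (rule sum.union_disjoint) (use finA in \<open>auto simp: A_def\<close>)
  also have "(\<Sum>e\<in>(\<lambda>e. p * e) ` A. parity_sign e * F e)
      = (\<Sum>e\<in>A. parity_sign (p * e) * F (p * e))"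
    by (simp add: sum.reindex[OF inj])
  also have "\<dots> = (\<Sum>e\<in>A. - (parity_sign e * F e))"
  proof (rule sum.cong[OF refl])
    fix e assume e: "e \<in> A"
    have "e > 0" "\<not> p dvd e" using e n by (auto simp: A_def sqfree_divisors_def intro!: Nat.gr0I)
    thus "parity_sign (p * e) * F (p * e) = - (parity_sign e * F e)"
      using parity_sign_mult_prime[of p e] F[OF pA[OF e]] p by simp
  qed
  finally show ?thesis by (simp add: sum_negf)
qed

text \<open>
  The Dirichlet convolution of the Moebius function with \<open>h\<close>, written over the squarefree
  divisors because the other terms of the convolution vanish.
\<close>

definition sieve_transform :: "(nat \<Rightarrow> real) \<Rightarrow> nat \<Rightarrow> real" where
  "sieve_transform h n = (\<Sum>e\<in>sqfree_divisors n. parity_sign e * h (n div e))"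

lemma sum_parity_sign:
  assumes "n > 0"
  shows "(\<Sum>e\<in>sqfree_divisors n. parity_sign e) = (if n = 1 then 1 else 0)"
proof (cases "n = 1")
  case True
  have "sqfree_divisors 1 = {1}" by (auto simp: sqfree_divisors_def)
  thus ?thesis using True by (simp add: parity_sign_def)
next
  case False
  then obtain p where "prime p" "p dvd n" using prime_factor_nat by blast
  from sqfree_divisors_sum_cancel[OF this assms, of "\<lambda>_. 1"] False show ?thesis by simp
qed

text \<open>
  Moebius inversion. Both double sums below range over the chains \<open>e | d | n\<close>; putting
  \<open>d = m e\<close> and summing over \<open>e | n / m\<close> first isolates the term \<open>m = n\<close>.
\<close>

lemma sum_sieve_transform_divisors:
  assumes n: "n > 0"
  shows "(\<Sum>d | d dvd n. sieve_transform h d) = h n"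
proof -
  have fin: "finite {d. d dvd n}" using n by simp
  have div_pos: "n div m > 0" if "m dvd n" for m
    using that n by (auto intro!: Nat.gr0I simp: dvd_div_eq_0_iff)
  have "(\<Sum>d | d dvd n. sieve_transform h d)
      = (\<Sum>(d,e)\<in>(SIGMA d:{d. d dvd n}. sqfree_divisors d). parity_sign e * h (d div e))"
    unfolding sieve_transform_def using fin n
    by (subst sum.Sigma) (auto intro!: finite_sqfree_divisors dvd_pos_nat[of n])
  also have "\<dots> = (\<Sum>(m,e)\<in>(SIGMA m:{m. m dvd n}. sqfree_divisors (n div m)). parity_sign e * h m)"
  proof (rule sum.reindex_bij_witness[where i = "\<lambda>(m,e). (m * e, e)" and j = "\<lambda>(d,e). (d div e, e)"])
    fix a assume "a \<in> (SIGMA d:{d. d dvd n}. sqfree_divisors d)"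
    then obtain d e k where a: "a = (d, e)" "d dvd n" "d = e * k" "squarefree e"
      by (fastforce simp: sqfree_divisors_def elim: dvdE)
    hence "e > 0" "k > 0" using n by (auto intro!: Nat.gr0I)
    moreover obtain l where "n = e * k * l" using a by auto
    ultimately show "(case (case a of (d, e) \<Rightarrow> (d div e, e)) of (m, e) \<Rightarrow> (m * e, e)) = a"
       "(case a of (d, e) \<Rightarrow> (d div e, e)) \<in> (SIGMA m:{m. m dvd n}. sqfree_divisors (n div m))"
       "(case (case a of (d, e) \<Rightarrow> (d div e, e)) of (m, e) \<Rightarrow> parity_sign e * h m)
          = (case a of (d, e) \<Rightarrow> parity_sign e * h (d div e))"
      using a by (auto simp: sqfree_divisors_def mult_ac)
  next
    fix b assume "b \<in> (SIGMA m:{m. m dvd n}. sqfree_divisors (n div m))"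
    then obtain m e k where b: "b = (m, e)" "m dvd n" "n div m = e * k" "squarefree e"
      by (fastforce simp: sqfree_divisors_def elim: dvdE[of _ "n div _"])
    hence nk: "n = m * (e * k)" by (metis dvd_mult_div_cancel)
    hence "e > 0" "m > 0" using n by (auto intro!: Nat.gr0I)
    thus "(case (case b of (m, e) \<Rightarrow> (m * e, e)) of (d, e) \<Rightarrow> (d div e, e)) = b"
       "(case b of (m, e) \<Rightarrow> (m * e, e)) \<in> (SIGMA d:{d. d dvd n}. sqfree_divisors d)"
      using b nk by (auto simp: sqfree_divisors_def mult_ac)
  qed
  also have "\<dots> = (\<Sum>m | m dvd n. h m * (\<Sum>e\<in>sqfree_divisors (n div m). parity_sign e))"
    using fin div_pos
    by (subst sum.Sigma[symmetric])
       (auto intro!: finite_sqfree_divisors sum.cong simp: sum_distrib_left mult_ac)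
  also have "\<dots> = (\<Sum>m | m dvd n. if m = n then h m else 0)"
  proof (rule sum.cong[OF refl])
    fix m assume "m \<in> {m. m dvd n}"
    then obtain k where k: "n = m * k" by auto
    hence mk: "m > 0" "k > 0" using n by (auto intro!: Nat.gr0I)
    hence "n div m = k" using k by simp
    thus "h m * (\<Sum>e\<in>sqfree_divisors (n div m). parity_sign e) = (if m = n then h m else 0)"
      using sum_parity_sign[of k] mk k by auto
  qed
  also have "\<dots> = h n" using fin by simp
  finally show ?thesis .
qed

lemma card_multiples_atMost:
  assumes "d > 0"
  shows "card {n\<in>{1..N}. d dvd n} = N div d"
proof -
  have "{n\<in>{1..N}. d dvd n} = (\<lambda>k. d * k) ` {1..N div d}"
  proof (intro equalityI subsetI)
    fix n assume "n \<in> {n\<in>{1..N}. d dvd n}"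
    then obtain k where "n = d * k" "1 \<le> n" "n \<le> N" by auto
    moreover have "k \<le> N div d"
      using calculation assms by (simp add: less_eq_div_iff_mult_less_eq mult.commute)
    ultimately show "n \<in> (\<lambda>k. d * k) ` {1..N div d}" by (auto intro!: imageI Suc_leI Nat.gr0I)
  next
    fix n assume "n \<in> (\<lambda>k. d * k) ` {1..N div d}"
    thus "n \<in> {n\<in>{1..N}. d dvd n}" using assms
      by (auto simp: less_eq_div_iff_mult_less_eq mult.commute)
  qed
  moreover have "inj_on (\<lambda>k. d * k) {1..N div d}" using assms by (auto simp: inj_on_def)
  ultimately show ?thesis by (simp add: card_image)
qed

lemma sum_eq_sum_sieve_transform:
  "(\<Sum>n=1..N. h n) = (\<Sum>d=1..N. sieve_transform h d * real (N div d))"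
proof -
  have "(\<Sum>n=1..N. h n) = (\<Sum>n=1..N. \<Sum>d\<in>{1..N}. if d dvd n then sieve_transform h d else 0)"
  proof (rule sum.cong[OF refl])
    fix n assume n: "n \<in> {1..N}"
    hence "{d\<in>{1..N}. d dvd n} = {d. d dvd n}"
      by (auto dest: dvd_imp_le intro!: Suc_leI Nat.gr0I)
    thus "h n = (\<Sum>d\<in>{1..N}. if d dvd n then sieve_transform h d else 0)"
      using sum_sieve_transform_divisors[of n h] n by (simp add: sum.If_cases Int_def)
  qed
  also have "\<dots> = (\<Sum>d=1..N. \<Sum>n\<in>{1..N}. if d dvd n then sieve_transform h d else 0)"
    by (rule sum.swap)
  also have "\<dots> = (\<Sum>d=1..N. sieve_transform h d * real (N div d))"
  proof (rule sum.cong[OF refl])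
    fix d assume "d \<in> {1..N}"
    thus "(\<Sum>n\<in>{1..N}. if d dvd n then sieve_transform h d else 0) = sieve_transform h d * real (N div d)"
      using card_multiples_atMost[of d N]
      by (subst sum.inter_filter[symmetric]) (simp_all add: mult.commute)
  qed
  finally show ?thesis .
qed

section \<open>Functions blind to simple prime factors\<close>

text \<open>
  A blind function depends only on the powerful part of its argument, as does any function of
  \<open>B n - \<beta> n\<close>. The condition is stated one prime at a time, which is the form in which the
  pairing argument consumes it.
\<close>

definition blind :: "(nat \<Rightarrow> real) \<Rightarrow> bool" where
  "blind h \<longleftrightarrow> (\<forall>p m. prime p \<and> \<not> p dvd m \<and> m > 0 \<longrightarrow> h (p * m) = h m)"

definition powerful :: "nat \<Rightarrow> bool" where
  "powerful n \<longleftrightarrow> (\<forall>p. prime p \<and> p dvd n \<longrightarrow> p ^ 2 dvd n)"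

text \<open>
  For positive powerful \<open>n\<close> this is \<open>2 ^ \<omega> n\<close>, with \<open>\<omega> n\<close> the number of primes dividing \<open>n\<close>. It
  is a bound for the transform that does not depend on \<open>h\<close>, which is the source of the
  uniformity in part (i).
\<close>

definition weight :: "nat \<Rightarrow> real" where
  "weight n = (if powerful n then real (card (sqfree_divisors n)) else 0)"

lemma weight_nonneg: "weight n \<ge> 0"
  by (simp add: weight_def)

text \<open>
  If \<open>p\<close> divides \<open>n\<close> exactly once, the paired divisors \<open>e\<close> and \<open>p e\<close> have cofactors \<open>p k\<close>
  and \<open>k\<close> with \<open>k\<close> prime to \<open>p\<close>, and a blind function does not distinguish them.
\<close>

lemma sieve_transform_eq_0:
  assumes "blind h" "\<not> powerful n" "n > 0"
  shows "sieve_transform h n = 0"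
proof -
  from assms obtain p where p: "prime p" "p dvd n" "\<not> p ^ 2 dvd n"
    by (auto simp: powerful_def)
  show ?thesis unfolding sieve_transform_def
  proof (rule sqfree_divisors_sum_cancel[OF p(1,2) assms(3)])
    fix e assume e: "p * e dvd n" "\<not> p dvd e"
    then obtain k where k: "n = p * e * k" by auto
    have pos: "p > 0" "e > 0" "k > 0" using k assms(3) by (auto intro!: Nat.gr0I)
    have "\<not> p dvd k"
    proof
      assume "p dvd k"
      then obtain l where "k = p * l" by auto
      hence "n = p ^ 2 * (e * l)" using k by (simp add: power2_eq_square)
      thus False using p by simp
    qed
    hence "h (p * k) = h k" using assms(1) p(1) pos by (auto simp: blind_def)
    moreover have "n div (p * e) = k" "n div e = p * k" using k pos by auto
    ultimately show "h (n div (p * e)) = h (n div e)" by simp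
  qed
qed

lemma abs_sieve_transform_le:
  assumes "blind h" "\<And>n. \<bar>h n\<bar> \<le> 1" "n > 0"
  shows "\<bar>sieve_transform h n\<bar> \<le> weight n"
proof (cases "powerful n")
  case True
  have "\<bar>sieve_transform h n\<bar> \<le> (\<Sum>e\<in>sqfree_divisors n. \<bar>parity_sign e * h (n div e)\<bar>)"
    unfolding sieve_transform_def by (rule sum_abs)
  also have "\<dots> \<le> (\<Sum>e\<in>sqfree_divisors n. 1)"
    by (intro sum_mono) (use assms(2) in \<open>simp add: parity_sign_def abs_mult\<close>)
  finally show ?thesis using True by (simp add: weight_def)
next
  case False
  thus ?thesis using sieve_transform_eq_0[OF assms(1) _ assms(3)] by (simp add: weight_def)
qed

section \<open>The size of the weights\<close>

text \<open>
  Write \<open>n = c s\<^sup>2\<close> with \<open>c\<close> squarefree. A prime dividing \<open>c\<close> divides the powerful number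
  \<open>n\<close> twice, hence divides \<open>s\<close>; so \<open>c | s\<close>, and \<open>s = c a\<close> gives \<open>n = a\<^sup>2 c\<^sup>3\<close>.
\<close>

lemma powerful_decompose:
  assumes "powerful n" "n > 0"
  obtains a b where "n = a ^ 2 * b ^ 3"
proof -
  define c s where "c = squarefree_part n" and "s = square_part n"
  have n: "n = c * s ^ 2" unfolding c_def s_def by (rule squarefree_decompose)
  have s0: "s \<noteq> 0" using assms by (auto simp: s_def)
  have c0: "c \<noteq> 0" by (simp add: c_def)
  have "c dvd s"
  proof (subst prime_multiplicity_le_imp_dvd[OF c0 s0], intro allI impI)
    fix p :: nat assume p: "prime p"
    show "multiplicity p c \<le> multiplicity p s"
    proof (cases "p dvd n")
      case True
      hence "p ^ 2 dvd n" using assms(1) p by (auto simp: powerful_def)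
      hence "p dvd s" by (simp add: s_def dvd_square_part_iff)
      hence "multiplicity p s \<ge> 1" using s0 p by (simp add: Suc_le_eq prime_multiplicity_gt_zero_iff)
      moreover have "multiplicity p c \<le> Suc 0" using p by (auto simp: c_def)
      ultimately show ?thesis by simp
    next
      case False
      hence "\<not> p dvd c" using n by auto
      thus ?thesis by (simp add: not_dvd_imp_multiplicity_0)
    qed
  qed
  then obtain a where "s = c * a" by auto
  hence "n = a ^ 2 * c ^ 3" using n by (simp add: power2_eq_square power3_eq_cube)
  thus ?thesis by (rule that)
qed

lemma sqfree_divisor_powerful_split:
  fixes a b e :: nat
  assumes "squarefree e" "e dvd a ^ 2 * b ^ 3"
  obtains a1 a2 b1 b2 where "a = a1 * a2" "b = b1 * b2" "e = a1 * b1"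
proof -
  have e0: "e \<noteq> 0" using assms(1) by (metis not_squarefree_0)
  have "e dvd a * b"
  proof (cases "a * b = 0")
    case False
    show ?thesis
    proof (subst prime_multiplicity_le_imp_dvd[OF e0 False], intro allI impI)
      fix p :: nat assume p: "prime p"
      show "multiplicity p e \<le> multiplicity p (a * b)"
      proof (cases "p dvd e")
        case True
        hence "p dvd a ^ 2 * b ^ 3" using assms(2) dvd_trans by blast
        hence "p dvd a * b" using p by (auto simp: prime_dvd_mult_iff dest: prime_dvd_power)
        hence "multiplicity p (a * b) \<ge> 1"
          using False p by (simp add: Suc_le_eq prime_multiplicity_gt_zero_iff)
        moreover have "multiplicity p e \<le> 1"
          using assms(1) e0 p by (auto simp: squarefree_factorial_semiring'')
        ultimately show ?thesis by simp
      qed (simp add: not_dvd_imp_multiplicity_0)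
    qed
  qed auto
  from division_decomp[OF this] obtain a1 b1 where "e = a1 * b1" "a1 dvd a" "b1 dvd b" by auto
  thus ?thesis using that by (auto elim!: dvdE)
qed

text \<open>
  The sum counts pairs of a powerful \<open>n \<le> N\<close> and a squarefree divisor \<open>e\<close> of it. Every such
  pair arises from a quadruple as \<open>n = (a1 a2)\<^sup>2 (b1 b2)\<^sup>3\<close> and \<open>e = a1 b1\<close>, so the pairs are
  at most as many as the quadruples. The variable \<open>a2\<close> is innermost because the count is
  estimated by solving for it.
\<close>

lemma sum_weight_le_card:
  "(\<Sum>n=1..N. weight n) \<le> real (card (SIGMA b1:{1..N}. SIGMA b2:{1..N}. SIGMA a1:{1..N}.
      {a2\<in>{1..N}. (a1 * a2) ^ 2 * (b1 * b2) ^ 3 \<le> N}))" (is "_ \<le> real (card ?Q)")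
proof -
  define \<phi> :: "nat \<times> nat \<times> nat \<times> nat \<Rightarrow> nat \<times> nat"
    where "\<phi> = (\<lambda>(b1, b2, a1, a2). ((a1 * a2) ^ 2 * (b1 * b2) ^ 3, a1 * b1))"
  define S where "S = (SIGMA n:{n\<in>{1..N}. powerful n}. sqfree_divisors n)"
  have finQ: "finite ?Q" by (intro finite_SigmaI) auto
  have "S \<subseteq> \<phi> ` ?Q"
  proof
    fix z assume "z \<in> S"
    then obtain n e where z: "z = (n, e)" and n: "powerful n" "1 \<le> n" "n \<le> N"
      and e: "squarefree e" "e dvd n"
      by (auto simp: S_def sqfree_divisors_def)
    obtain a b where ab: "n = a ^ 2 * b ^ 3" using powerful_decompose[of n] n by auto
    obtain a1 a2 b1 b2 where split: "a = a1 * a2" "b = b1 * b2" "e = a1 * b1"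
      using sqfree_divisor_powerful_split[of e a b, OF e(1) e(2)[unfolded ab]] by blast
    have le: "u \<le> N" "u > 0" if "u dvd n" for u
      using that n dvd_imp_le[of u n] by (auto intro: dvd_pos_nat)
    have "a dvd n" "b dvd n" using ab by (auto simp: power2_eq_square power3_eq_cube)
    hence "a1 dvd n" "a2 dvd n" "b1 dvd n" "b2 dvd n"
      using split by (auto dest: dvd_mult_left dvd_mult_right)
    hence "(b1, b2, a1, a2) \<in> ?Q"
      using le ab split n by (auto simp: Suc_le_eq)
    moreover have "z = \<phi> (b1, b2, a1, a2)"
      using z ab split by (simp add: \<phi>_def)
    ultimately show "z \<in> \<phi> ` ?Q" by blast
  qed
  hence "card S \<le> card ?Q" using finQ by (meson card_image_le card_mono finite_imageI le_trans)
  hence "real (card S) \<le> real (card ?Q)" by (rule of_nat_mono)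
  moreover have "(\<Sum>n=1..N. weight n) = real (card S)"
  proof -
    have "real (card S) = (\<Sum>n | n \<in> {1..N} \<and> powerful n. real (card (sqfree_divisors n)))"
      unfolding S_def by (subst card_SigmaI) (auto intro!: finite_sqfree_divisors)
    also have "\<dots> = (\<Sum>n=1..N. if powerful n then real (card (sqfree_divisors n)) else 0)"
      by (rule sum.inter_filter) simp
    finally show ?thesis by (simp add: weight_def)
  qed
  ultimately show ?thesis by (rule ord_eq_le_trans[rotated])
qed

lemma isolate_factor_le:
  fixes u v w y z :: real
  assumes "w * y * (u * v) \<le> z" "0 < w" "0 < u" "0 < v"
  shows "y \<le> z * (1 / u * (1 / v * inverse w))"
proof -
  have "y * (w * u * v) \<le> z" using assms(1) by (simp add: mult_ac)
  hence "y \<le> z / (w * u * v)" using assms by (simp add: pos_le_divide_eq)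
  thus ?thesis by (simp add: divide_inverse mult_ac)
qed

lemma card_quadratic_fibre:
  fixes a1 b1 b2 N :: nat
  assumes "a1 > 0" "b1 > 0" "b2 > 0"
  shows "real (card {a2\<in>{1..N}. (a1 * a2) ^ 2 * (b1 * b2) ^ 3 \<le> N})
    \<le> sqrt N * (real b1 powr (-3/2) * (real b2 powr (-3/2) * inverse (real a1)))" (is "real (card ?A) \<le> ?t")
proof -
  have pw: "real b powr (-3/2) = 1 / sqrt (real b) ^ 3" if "b > 0" for b
  proof -
    have "sqrt (real b) ^ 3 = real b powr (1/2 * 3)"
      using that by (simp add: powr_half_sqrt[symmetric] powr_power)
    thus ?thesis by (simp add: powr_minus_divide)
  qed
  have "?A \<subseteq> {1..nat \<lfloor>?t\<rfloor>}"
  proof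
    fix a2 assume a2: "a2 \<in> ?A"
    have "(real a1 * real a2 * (sqrt b1 * sqrt b2) ^ 3) ^ 2
        = (real a1 * real a2) ^ 2 * ((sqrt b1 * sqrt b2) ^ 2) ^ 3"
      by (simp only: power_mult_distrib[of _ "_ ^ 3"] power_mult[symmetric] mult.commute[of 3])
    also have "\<dots> = real ((a1 * a2) ^ 2 * (b1 * b2) ^ 3)" by (simp add: power_mult_distrib)
    also have "\<dots> \<le> real N" using a2 by (subst of_nat_le_iff) auto
    finally have "real a1 * real a2 * (sqrt b1 * sqrt b2) ^ 3 \<le> sqrt N"
      by (rule real_le_rsqrt)
    from isolate_factor_le[OF this[unfolded power_mult_distrib[of "sqrt b1"]]]
    have "real a2 \<le> ?t"
      unfolding pw[OF assms(2)] pw[OF assms(3)] using assms by simp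
    thus "a2 \<in> {1..nat \<lfloor>?t\<rfloor>}" using a2 by (auto simp: le_nat_floor)
  qed
  hence "card ?A \<le> nat \<lfloor>?t\<rfloor>" using card_mono[of "{1..nat \<lfloor>?t\<rfloor>}" ?A] by simp
  hence "real (card ?A) \<le> real (nat \<lfloor>?t\<rfloor>)" by (rule of_nat_mono)
  also have "\<dots> \<le> ?t" by (intro of_nat_floor mult_nonneg_nonneg) auto
  finally show ?thesis .
qed

lemma sum_inverse_le_ln:
  assumes "N \<ge> 2"
  shows "(\<Sum>a=1..N. inverse (real a)) \<le> 3 * ln (real N)"
proof -
  have "harm N - ln (real N) \<le> harm 1 - ln (real 1)"
    using euler_mascheroni_sequence_decreasing[of 1 N] assms by simp
  moreover have "ln 2 \<le> ln (real N)" using assms by simp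
  ultimately show ?thesis using ln2_ge_two_thirds by (simp add: harm_def)
qed

text \<open>
  After solving for \<open>a2\<close>, the sum over the quadruples factors: the sums over \<open>b1\<close> and \<open>b2\<close>
  converge with exponent \<open>3/2\<close>, and the harmonic sum over \<open>a1\<close> produces the only logarithm.
\<close>

lemma sum_weight_bound:
  obtains C where "C > 0" "\<And>N. N \<ge> 2 \<Longrightarrow> (\<Sum>n=1..N. weight n) \<le> C * (sqrt N * ln N)"
proof -
  define u where "u = (\<lambda>b. real b powr (-3/2))"
  have sm: "summable u" unfolding u_def by (subst summable_real_powr_iff) simp
  define Z where "Z = suminf u"
  have u: "u b \<ge> 0" for b by (simp add: u_def)
  have Z: "(\<Sum>b=1..N. u b) \<le> Z" for N
    unfolding Z_def by (rule sum_le_suminf[OF sm]) (auto simp: u)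
  have Z0: "Z \<ge> 0" using Z[of 0] by simp
  have "(\<Sum>n=1..N. weight n) \<le> (3 * Z^2 + 1) * (sqrt N * ln N)" if N: "N \<ge> 2" for N
  proof -
    have "(\<Sum>n=1..N. weight n) \<le> (\<Sum>b1=1..N. \<Sum>b2=1..N. \<Sum>a1=1..N.
        real (card {a2\<in>{1..N}. (a1 * a2) ^ 2 * (b1 * b2) ^ 3 \<le> N}))"
      using sum_weight_le_card[of N] by (simp add: card_SigmaI)
    also have "\<dots> \<le> (\<Sum>b1=1..N. \<Sum>b2=1..N. \<Sum>a1=1..N.
        sqrt N * (u b1 * (u b2 * inverse (real a1))))"
      unfolding u_def by (intro sum_mono card_quadratic_fibre) auto
    also have "\<dots> = sqrt N * ((\<Sum>b=1..N. u b) * ((\<Sum>b=1..N. u b) * (\<Sum>a=1..N. inverse (real a))))"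
      by (simp add: sum_distrib_left[symmetric] sum_distrib_right[symmetric])
    also have "\<dots> \<le> sqrt N * (Z * (Z * (3 * ln N)))"
      using Z[of N] Z0 sum_inverse_le_ln[OF N]
      by (intro mult_left_mono mult_mono) (auto intro!: sum_nonneg mult_nonneg_nonneg simp: u)
    also have "\<dots> \<le> (3 * Z^2 + 1) * (sqrt N * ln N)"
      using N by (simp add: power2_eq_square algebra_simps)
    finally show ?thesis .
  qed
  moreover have "3 * Z^2 + 1 > 0" by (simp add: add_nonneg_pos)
  ultimately show ?thesis using that by blast
qed

text \<open>
  Dyadic summation of the tail is organised by the potential \<open>6 (ln N + 5) / sqrt N\<close>: passing
  from \<open>N\<close> to \<open>2 N\<close> lowers it by at least the bound for the block between the two. Here
  \<open>L = ln N\<close> and \<open>s = sqrt N\<close>. The factor \<open>1 / sqrt 2 < 3/4\<close> leaves a quarter of the leading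
  term \<open>6 L\<close>, enough to pay for \<open>sqrt 2 L\<close>; the shift \<open>5\<close> absorbs the bounded terms.
\<close>

lemma tail_potential_decrease:
  fixes L s :: real
  assumes "L \<ge> 0" "s > 0"
  shows "sqrt 2 * (L + ln 2) / s \<le> 6 * (L + 5) / s - 6 * (L + ln 2 + 5) / (sqrt 2 * s)"
proof -
  have r: "4 / 3 \<le> sqrt (2::real)" "sqrt (2::real) \<le> 3 / 2"
    by (intro real_le_rsqrt real_le_lsqrt; simp add: power2_eq_square)+
  have l: "ln (2::real) \<le> 1" "ln (2::real) \<ge> 0"
    using ln_le_minus_one[of "2::real"] by simp_all
  have half: "1 / sqrt (2::real) \<le> 3 / 4"
    using r by (simp add: field_simps)
  have "sqrt 2 * (L + ln 2) \<le> 3 / 2 * (L + 1)"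
    using r l assms by (intro mult_mono) auto
  moreover have "(6 * (L + ln 2 + 5)) * (1 / sqrt 2) \<le> (6 * (L + 6)) * (3 / 4)"
    using half l assms by (intro mult_mono) auto
  hence "6 * (L + ln 2 + 5) / sqrt 2 \<le> 6 * (L + 6) * (3 / 4)" by simp
  ultimately have "sqrt 2 * (L + ln 2) \<le> 6 * (L + 5) - 6 * (L + ln 2 + 5) / sqrt 2"
    using assms(1) by argo
  hence "sqrt 2 * (L + ln 2) / s \<le> (6 * (L + 5) - 6 * (L + ln 2 + 5) / sqrt 2) / s"
    using assms by (intro divide_right_mono) auto
  thus ?thesis by (simp add: diff_divide_distrib)
qed

lemma weight_tail_bound:
  obtains C where "C > 0"
    "\<And>N M. N \<ge> 2 \<Longrightarrow> (\<Sum>n\<in>{N<..M}. weight n / real n) \<le> C * (ln N / sqrt N)"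
proof -
  obtain C where C: "C > 0" "\<And>N. N \<ge> 2 \<Longrightarrow> (\<Sum>n=1..N. weight n) \<le> C * (sqrt N * ln N)"
    using sum_weight_bound by blast
  \<comment> \<open>The potential of the preceding lemma, scaled by the constant of the bound for the weights.\<close>
  define \<phi> where "\<phi> = (\<lambda>N::nat. C * (6 * (ln N + 5) / sqrt N))"
  have dyadic: "(\<Sum>n\<in>{N<..2*N}. weight n / real n) \<le> \<phi> N - \<phi> (2 * N)" if N: "N \<ge> 2" for N
  proof -
    have "(\<Sum>n\<in>{N<..2*N}. weight n / real n) \<le> (\<Sum>n\<in>{N<..2*N}. weight n / real N)"
      using N by (intro sum_mono divide_left_mono) (auto simp: weight_nonneg)
    also have "\<dots> \<le> (\<Sum>n=1..2*N. weight n / real N)"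
      using N by (intro sum_mono2) (auto simp: weight_nonneg)
    also have "\<dots> = (\<Sum>n=1..2*N. weight n) / real N" by (simp add: sum_divide_distrib)
    also have "\<dots> \<le> C * (sqrt (2 * N) * ln (2 * N)) / real N"
      using C(2)[of "2 * N"] N by (intro divide_right_mono) auto
    also have "\<dots> = C * (sqrt 2 * (ln N + ln 2) / sqrt N)"
    proof -
      have "C * (sqrt (2 * N) * ln (2 * N)) / real N = C * (sqrt 2 * (ln N + ln 2) * (sqrt N / real N))"
        using N by (simp add: real_sqrt_mult ln_mult)
      also have "sqrt N / real N = 1 / sqrt N" by (simp add: sqrt_divide_self_eq inverse_eq_divide)
      finally show ?thesis by simp
    qed
    also have "\<dots> \<le> C * (6 * (ln N + 5) / sqrt N - 6 * (ln N + ln 2 + 5) / (sqrt 2 * sqrt N))"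
      using C(1) N by (intro mult_left_mono tail_potential_decrease) auto
    also have "\<dots> = \<phi> N - \<phi> (2 * N)"
      using N by (simp add: \<phi>_def real_sqrt_mult ln_mult algebra_simps)
    finally show ?thesis .
  qed
  \<comment> \<open>The block estimates telescope.\<close>
  have iter: "(\<Sum>n\<in>{N<..2^j*N}. weight n / real n) \<le> \<phi> N - \<phi> (2^j * N)" if N: "N \<ge> 2" for N j
  proof (induction j)
    case (Suc j)
    have N_le: "N \<le> 2 ^ j * N" by simp
    have "{N<..2^Suc j*N} = {N<..2^j*N} \<union> {2^j*N<..2*(2^j*N)}"
      using ivl_disj_un_two(6)[OF N_le, of "2 * (2^j * N)"] by (simp add: mult.assoc)
    hence "(\<Sum>n\<in>{N<..2^Suc j*N}. weight n / real n)
        = (\<Sum>n\<in>{N<..2^j*N}. weight n / real n) + (\<Sum>n\<in>{2^j*N<..2*(2^j*N)}. weight n / real n)"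
      by (simp only:) (rule sum.union_disjoint, auto)
    also have "\<dots> \<le> (\<phi> N - \<phi> (2^j * N)) + (\<phi> (2^j * N) - \<phi> (2 * (2^j * N)))"
      by (rule add_mono[OF Suc.IH dyadic]) (use N N_le in linarith)
    finally show ?case by (simp add: mult.assoc)
  qed simp
  have "(\<Sum>n\<in>{N<..M}. weight n / real n) \<le> (60 * C) * (ln N / sqrt N)" if N: "N \<ge> 2" for N M
  proof -
    have "M * 1 \<le> 2 ^ M * N" using N less_exp[of M] by (intro mult_le_mono) auto
    hence "M \<le> 2 ^ M * N" by simp
    hence "(\<Sum>n\<in>{N<..M}. weight n / real n) \<le> (\<Sum>n\<in>{N<..2^M*N}. weight n / real n)"
      by (intro sum_mono2) (auto simp: weight_nonneg)
    also have "\<dots> \<le> \<phi> N - \<phi> (2^M * N)" by (rule iter[OF N])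
    also have "\<dots> \<le> \<phi> N"
    proof -
      have "1 \<le> 2 ^ M * N" using N by (simp add: Suc_le_eq)
      hence "real (2^M * N) \<ge> 1" using of_nat_mono[of 1 "2^M * N"] unfolding of_nat_1 by blast
      hence "ln (real (2^M * N)) \<ge> 0" by (rule ln_ge_zero)
      thus ?thesis using C(1) by (simp add: \<phi>_def)
    qed
    also have "\<dots> \<le> (60 * C) * (ln N / sqrt N)"
    proof -
      have "ln 2 \<le> ln (real N)" using N by simp
      hence "2 / 3 \<le> ln (real N)" by (rule order_trans[OF ln2_ge_two_thirds])
      hence "6 * (ln N + 5) \<le> 60 * ln (real N)" by simp
      hence "C * (6 * (ln N + 5) / sqrt N) \<le> C * (60 * ln N / sqrt N)"
        using C(1) by (intro mult_left_mono divide_right_mono) auto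
      thus ?thesis by (simp add: \<phi>_def)
    qed
    finally show ?thesis .
  qed
  thus ?thesis using that[of "60 * C"] C(1) by auto
qed

section \<open>Mean values of blind functions\<close>

lemma real_div_nat_bounds:
  "real (N div n) \<le> real N / real n" "real N / real n \<le> real (N div n) + 1"
  using floor_correct[of "real N / real n"] by (simp_all add: floor_divide_of_nat_eq)

text \<open>
  With \<open>g = sieve_transform h\<close>, the sum of \<open>h\<close> up to \<open>N\<close> is the sum of \<open>g d (N div d)\<close>. The mean
  value is the sum of the series \<open>g d / d\<close>. The three errors come from replacing \<open>N div d\<close> by
  \<open>N / d\<close> (bounded by the sum of the weights), from completing the series (bounded by the
  weighted tail) and from replacing the integer \<open>N\<close> by the real \<open>x\<close>. None of the bounds sees
  \<open>h\<close>, so \<open>C\<close> is chosen before \<open>h\<close>.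
\<close>

lemma blind_mean_value:
  obtains C where "C > 0"
    "\<And>h. blind h \<Longrightarrow> (\<And>n. \<bar>h n\<bar> \<le> 1) \<Longrightarrow>
      \<exists>M. \<forall>x::real\<ge>2. \<bar>(\<Sum>n=1..nat \<lfloor>x\<rfloor>. h n) - M * x\<bar> \<le> C * (x powr (1/2) * ln x)"
proof -
  obtain C1 where C1: "C1 > 0" "\<And>N. N \<ge> 2 \<Longrightarrow> (\<Sum>n=1..N. weight n) \<le> C1 * (sqrt N * ln N)"
    using sum_weight_bound by blast
  obtain C2 where C2: "C2 > 0"
    "\<And>N M. N \<ge> 2 \<Longrightarrow> (\<Sum>n\<in>{N<..M}. weight n / real n) \<le> C2 * (ln N / sqrt N)"
    using weight_tail_bound by blast
  define K where "K = (\<Sum>n=1..2. weight n / real n) + C2 * (ln (real 2) / sqrt (real 2))"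
  have K0: "K \<ge> 0" unfolding K_def using C2(1)
    by (intro add_nonneg_nonneg sum_nonneg) (auto simp: weight_nonneg)
  have K: "(\<Sum>n=1..N. weight n / real n) \<le> K" for N
  proof -
    have "(\<Sum>n=1..N. weight n / real n) \<le> (\<Sum>n\<in>{1..2} \<union> {2<..N}. weight n / real n)"
      by (intro sum_mono2) (auto simp: weight_nonneg)
    also have "\<dots> = (\<Sum>n=1..2. weight n / real n) + (\<Sum>n\<in>{2<..N}. weight n / real n)"
      by (rule sum.union_disjoint) auto
    also have "\<dots> \<le> K" unfolding K_def using C2(2)[of 2 N] by simp
    finally show ?thesis .
  qed
  have main: "\<exists>M. \<forall>x::real\<ge>2. \<bar>(\<Sum>n=1..nat \<lfloor>x\<rfloor>. h n) - M * x\<bar>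
      \<le> (C1 + C2 + 2 * K) * (x powr (1/2) * ln x)"
    if h: "blind h" "\<And>n. \<bar>h n\<bar> \<le> 1" for h
  proof -
    define g where "g = sieve_transform h"
    have g: "\<bar>g n\<bar> \<le> weight n" if "n > 0" for n
      unfolding g_def by (rule abs_sieve_transform_le[OF h that])
    have gn: "\<bar>g n / real n\<bar> \<le> weight n / real n" for n
      using g[of n] by (cases "n = 0") (auto simp: divide_right_mono)
    define G where "G = (\<lambda>N. \<Sum>n=1..N. g n / real n)"
    have G_eq: "G N = (\<Sum>n\<le>N. g n / real n)" for N
      unfolding G_def by (rule sum.mono_neutral_left) (auto simp: Suc_le_eq)
    have "summable (\<lambda>n. \<bar>g n / real n\<bar>)"
    proof (rule bounded_imp_summable)
      fix N
      have "(\<Sum>n\<le>N. \<bar>g n / real n\<bar>) = (\<Sum>n=1..N. \<bar>g n / real n\<bar>)"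
        by (rule sum.mono_neutral_right) (auto simp: Suc_le_eq)
      also have "\<dots> \<le> (\<Sum>n=1..N. weight n / real n)" by (intro sum_mono gn)
      also note K
      finally show "(\<Sum>n\<le>N. \<bar>g n / real n\<bar>) \<le> K" .
    qed simp
    hence "summable (\<lambda>n. g n / real n)" by (rule summable_rabs_cancel)
    then obtain M where M: "G \<longlonglongrightarrow> M"
      unfolding G_eq[abs_def] by (auto simp: summable_def sums_def_le)
    have MG: "\<bar>M - G N\<bar> \<le> C2 * (ln N / sqrt N)" if N: "N \<ge> 2" for N
    proof (rule LIMSEQ_le_const2)
      show "(\<lambda>m. \<bar>G m - G N\<bar>) \<longlonglongrightarrow> \<bar>M - G N\<bar>"
        by (intro tendsto_intros M)
      have "\<bar>G m - G N\<bar> \<le> C2 * (ln N / sqrt N)" if m: "m \<ge> N" for m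
      proof -
        have "{1..m} = {1..N} \<union> {N<..m}" using m by auto
        hence "G m = G N + (\<Sum>n\<in>{N<..m}. g n / real n)"
          unfolding G_def by (simp only:) (rule sum.union_disjoint, auto)
        hence "\<bar>G m - G N\<bar> \<le> (\<Sum>n\<in>{N<..m}. \<bar>g n / real n\<bar>)"
          by (simp only: add_diff_cancel_left' sum_abs)
        also have "\<dots> \<le> (\<Sum>n\<in>{N<..m}. weight n / real n)" by (intro sum_mono gn)
        also have "\<dots> \<le> C2 * (ln N / sqrt N)" by (rule C2(2)[OF N])
        finally show ?thesis .
      qed
      thus "\<exists>n0. \<forall>m\<ge>n0. \<bar>G m - G N\<bar> \<le> C2 * (ln N / sqrt N)" by blast
    qed
    have "\<bar>G N\<bar> \<le> K" for N
    proof -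
      have "\<bar>G N\<bar> \<le> (\<Sum>n=1..N. \<bar>g n / real n\<bar>)" unfolding G_def by (rule sum_abs)
      also have "\<dots> \<le> (\<Sum>n=1..N. weight n / real n)" by (intro sum_mono gn)
      finally show ?thesis using K[of N] by linarith
    qed
    hence MK: "\<bar>M\<bar> \<le> K"
      by (intro LIMSEQ_le_const2[OF tendsto_rabs[OF M]]) auto
    have "\<bar>(\<Sum>n=1..nat \<lfloor>x\<rfloor>. h n) - M * x\<bar> \<le> (C1 + C2 + 2 * K) * (x powr (1/2) * ln x)"
      if x: "x \<ge> 2" for x :: real
    proof -
      define N where "N = nat \<lfloor>x\<rfloor>"
      have N: "N \<ge> 2" "real N \<le> x" "x \<le> real N + 1"
        using x unfolding N_def by (auto simp: le_nat_floor of_nat_floor)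
      \<comment> \<open>Replacing the integer quotients by real ones costs at most the weight at each place.\<close>
      have "\<bar>(\<Sum>n=1..N. g n * real (N div n)) - N * G N\<bar> \<le> (\<Sum>n=1..N. weight n)"
      proof -
        have "(\<Sum>n=1..N. g n * real (N div n)) - N * G N
            = (\<Sum>n=1..N. g n * (real (N div n) - real N / real n))"
          unfolding G_def by (simp add: sum_distrib_left sum_subtractf[symmetric] algebra_simps)
        also have "\<bar>\<dots>\<bar> \<le> (\<Sum>n=1..N. \<bar>g n * (real (N div n) - real N / real n)\<bar>)" by (rule sum_abs)
        also have "\<dots> \<le> (\<Sum>n=1..N. weight n)"
        proof (rule sum_mono)
          fix n assume n: "n \<in> {1..N}"
          have "\<bar>real (N div n) - real N / real n\<bar> \<le> 1"
            using real_div_nat_bounds[of N n] by linarith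
          hence "\<bar>g n\<bar> * \<bar>real (N div n) - real N / real n\<bar> \<le> weight n * 1"
            using g[of n] n by (intro mult_mono) (auto simp: weight_nonneg)
          thus "\<bar>g n * (real (N div n) - real N / real n)\<bar> \<le> weight n" by (simp add: abs_mult)
        qed
        finally show ?thesis .
      qed
      also note C1(2)[OF N(1)]
      finally have 1: "\<bar>(\<Sum>n=1..N. h n) - N * G N\<bar> \<le> C1 * (sqrt N * ln N)"
        by (simp only: g_def sum_eq_sum_sieve_transform[of h])
      have "\<bar>N * G N - M * N\<bar> = N * \<bar>M - G N\<bar>"
      proof -
        have "N * G N - M * N = - (N * (M - G N))" by (simp add: algebra_simps)
        thus ?thesis by (simp only: abs_minus abs_mult abs_of_nat)
      qed
      also have "\<dots> \<le> N * (C2 * (ln N / sqrt N))" by (intro mult_left_mono MG N) auto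
      also have "\<dots> = C2 * ((N / sqrt N) * ln N)" by simp
      also have "N / sqrt N = sqrt N" by (simp add: real_div_sqrt)
      finally have 2: "\<bar>N * G N - M * N\<bar> \<le> C2 * (sqrt N * ln N)" .
      have "\<bar>M * N - M * x\<bar> = \<bar>M\<bar> * \<bar>N - x\<bar>" by (simp add: abs_mult[symmetric] algebra_simps)
      also have "\<dots> \<le> K * 1" using MK N by (intro mult_mono) auto
      finally have 3: "\<bar>M * N - M * x\<bar> \<le> K" by simp
      define E where "E = sqrt x * ln x"
      have "sqrt N * ln N \<le> E" unfolding E_def using N by (intro mult_mono) auto
      hence 4: "C1 * (sqrt N * ln N) \<le> C1 * E" "C2 * (sqrt N * ln N) \<le> C2 * E"
        using C1(1) C2(1) by auto
      have "ln 2 \<le> ln x" "1 \<le> sqrt x" using x by auto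
      moreover from this have "1 / 2 \<le> ln x" using ln2_ge_two_thirds by linarith
      ultimately have "1 * (1 / 2) \<le> E" unfolding E_def by (intro mult_mono) auto
      hence "K * 1 \<le> K * (2 * E)" using K0 by (intro mult_left_mono) auto
      hence "\<bar>(\<Sum>n=1..N. h n) - M * x\<bar> \<le> (C1 + C2 + 2 * K) * E"
        using 1 2 3 4 by (simp add: distrib_right)
      thus ?thesis using x by (simp add: E_def N_def powr_half_sqrt)
    qed
    thus ?thesis by blast
  qed
  have "C1 + C2 + 2 * K > 0" using C1(1) C2(1) K0 by simp
  thus ?thesis using main that by blast
qed

section \<open>The difference of the two additive functions\<close>

text \<open>
  In \<open>B n - \<beta> n\<close> each prime counts once for every repetition beyond its first occurrence
  in \<open>n\<close>, whence the insensitivity to simple prime factors.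
\<close>

definition excess :: "nat \<Rightarrow> nat" where
  "excess n = B_add n - beta_add n"

lemma excess_altdef: "excess n = (\<Sum>p\<in>prime_factors n. (multiplicity p n - 1) * p)"
proof -
  have "excess n = (\<Sum>p\<in>prime_factors n. multiplicity p n * p - p)"
    unfolding excess_def B_add_def beta_add_def
    by (rule sum_subtractf_nat[symmetric]) (simp add: prime_factors_multiplicity)
  thus ?thesis by (simp add: diff_mult_distrib)
qed

lemma excess_mult_prime:
  assumes p: "prime p" "\<not> p dvd m" and m: "m > 0"
  shows "excess (p * m) = excess m"
proof -
  have pf: "prime_factors (p * m) = insert p (prime_factors m)"
    using p m by (subst prime_factors_product) (auto simp: prime_prime_factors prime_gt_0_nat)
  have "p \<notin> prime_factors m" using p by auto
  moreover have "multiplicity p (p * m) = 1"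
    using p m by (subst multiplicity_times_same)
      (auto simp: not_dvd_imp_multiplicity_0 prime_gt_0_nat)
  moreover have "multiplicity q (p * m) = multiplicity q m" if "q \<in> prime_factors m" for q
  proof -
    have "prime q" "q \<noteq> p" using that p by auto
    hence "\<not> q dvd p" using p(1) primes_dvd_imp_eq by blast
    thus ?thesis using \<open>prime q\<close> p m
      by (subst prime_elem_multiplicity_mult_distrib)
         (auto simp: not_dvd_imp_multiplicity_0 prime_gt_0_nat)
  qed
  ultimately show ?thesis by (simp add: excess_altdef pf)
qed

lemma excess_squarefree:
  assumes "squarefree n"
  shows "excess n = 0"
proof -
  have "n \<noteq> 0" using assms by (metis not_squarefree_0)
  hence "multiplicity p n \<le> 1" if "p \<in> prime_factors n" for p
    using assms that by (auto simp: squarefree_factorial_semiring'')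
  thus ?thesis by (simp add: excess_altdef)
qed

text \<open>
  Numbers \<open>x, y \<ge> 2\<close> satisfy \<open>x + y \<le> x y\<close>, so bounds \<open>t \<le> 2 u\<close> at the single
  indices combine on the product side, provided that indices with \<open>u = 1\<close> contribute nothing.
  The conclusion repeats the alternative of the hypothesis so that it survives induction.
\<close>

lemma sum_le_twice_prod:
  fixes t u :: "'a \<Rightarrow> nat"
  assumes "finite A" "\<And>a. a \<in> A \<Longrightarrow> t a = 0 \<and> u a > 0 \<or> t a \<le> 2 * u a \<and> u a \<ge> 2"
  shows "sum t A = 0 \<and> prod u A > 0 \<or> sum t A \<le> 2 * prod u A \<and> prod u A \<ge> 2"
  using assms
proof (induction A rule: finite_induct)
  case (insert a A)
  have plus_le_times: "x + y \<le> x * y" if "x \<ge> 2" "y \<ge> 2" for x y :: nat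
  proof -
    have "x * 2 \<le> x * y" "2 * y \<le> x * y" using that by (auto intro!: mult_le_mono)
    thus ?thesis by linarith
  qed
  have a: "t a = 0 \<and> u a > 0 \<or> t a \<le> 2 * u a \<and> u a \<ge> 2" using insert.prems by auto
  have A: "sum t A = 0 \<and> prod u A > 0 \<or> sum t A \<le> 2 * prod u A \<and> prod u A \<ge> 2"
    using insert.IH insert.prems by auto
  have mono: "prod u A \<le> u a * prod u A" "u a \<le> u a * prod u A" using a A by auto
  have "t a + sum t A = 0 \<and> u a * prod u A > 0
     \<or> t a + sum t A \<le> 2 * (u a * prod u A) \<and> u a * prod u A \<ge> 2"
    using a A
  proof (elim disjE conjE)
    assume "t a \<le> 2 * u a" "2 \<le> u a" "sum t A \<le> 2 * prod u A" "2 \<le> prod u A"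
    thus ?thesis using mono plus_le_times[of "u a" "prod u A"] by linarith
  qed (use mono in linarith)+
  thus ?case using insert.hyps by simp
qed simp

text \<open>
  A prime with exponent \<open>\<alpha> \<ge> 2\<close> adds \<open>(\<alpha> - 1) p\<close> to the excess and the factor
  \<open>p ^ (\<alpha> div 2)\<close> to the square part. With \<open>\<alpha> div 2 = j + 1\<close> the former is at most
  \<open>2 (j + 1) p\<close>, and \<open>j + 1 \<le> 2 ^ j \<le> p ^ j\<close>. Large excess thus forces a large square divisor.
\<close>

lemma excess_le_square_part:
  assumes "n > 0"
  shows "excess n \<le> 2 * square_part n"
proof -
  define t where "t = (\<lambda>p. (multiplicity p n - 1) * p)"
  define u where "u = (\<lambda>p. p ^ (multiplicity p n div 2))"
  have "sum t (prime_factors n) \<le> 2 * prod u (prime_factors n)"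
  proof -
    have "t p = 0 \<and> u p > 0 \<or> t p \<le> 2 * u p \<and> u p \<ge> 2" if "p \<in> prime_factors n" for p
    proof (cases "multiplicity p n \<le> 1")
      case True
      have "p > 0" using that by (auto intro: prime_gt_0_nat)
      thus ?thesis using True by (simp add: t_def u_def)
    next
      case False
      then obtain j where j: "multiplicity p n div 2 = Suc j" by (cases "multiplicity p n div 2") auto
      have p: "p \<ge> 2" using that by (auto intro: prime_ge_2_nat)
      have "Suc j \<le> 2 ^ j" by (rule Suc_leI) (rule less_exp)
      also have "\<dots> \<le> p ^ j" using p by (rule power_mono) simp
      finally have "Suc j \<le> p ^ j" .
      moreover have "multiplicity p n - 1 \<le> 2 * Suc j"
      proof -
        have "a - 1 \<le> 2 * Suc j" if "a div 2 = Suc j" for a :: nat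
          using that by presburger
        thus ?thesis using j by blast
      qed
      ultimately have "(multiplicity p n - 1) * p \<le> (2 * p ^ j) * p"
        by (intro mult_right_mono) auto
      moreover have "2 * 1 \<le> p * p ^ j" using p by (intro mult_mono) auto
      ultimately show ?thesis by (simp add: t_def u_def j mult_ac)
    qed
    from sum_le_twice_prod[OF finite_set_mset, of "prime_factorization n" t u, OF this] show ?thesis by auto
  qed
  thus ?thesis using assms by (simp add: excess_altdef square_part_nonzero t_def u_def)
qed

text \<open>Telescoping, through \<open>1 / (m + 1)\<^sup>2 \<le> 1 / m - 1 / (m + 1)\<close>.\<close>

lemma sum_inverse_squares_tail:
  assumes "K \<ge> 1"
  shows "(\<Sum>m=K..N. 1 / real m ^ 2) \<le> 2 / real K"
proof (cases "K \<le> N")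
  case True
  \<comment> \<open>The strengthening by \<open>1 / N\<close> is what makes the induction go through.\<close>
  have "(\<Sum>m=K..N. 1 / real m ^ 2) \<le> 2 / real K - 1 / real N"
    using True
  proof (induction N rule: dec_induct)
    case base
    show ?case using assms by (simp add: field_simps power2_eq_square)
  next
    case (step n)
    have "1 / real (Suc n) ^ 2 \<le> 1 / (real n * real (Suc n))"
      unfolding power2_eq_square using step.hyps assms
      by (intro divide_left_mono mult_right_mono mult_pos_pos) auto
    also have "\<dots> = 1 / real n - 1 / real (Suc n)"
      using step.hyps assms by (simp add: field_simps)
    finally have "1 / real (Suc n) ^ 2 \<le> 1 / real n - 1 / real (Suc n)" .
    thus ?case using step by simp
  qed
  thus ?thesis by (smt (verit) divide_nonneg_nonneg of_nat_0_le_iff)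
qed simp

text \<open>
  An excess of at least \<open>k\<close> gives a divisor \<open>m\<^sup>2\<close> with \<open>2 m \<ge> k\<close>. The multiples of \<open>m\<^sup>2\<close> up
  to \<open>N\<close> number at most \<open>N / m\<^sup>2\<close>, and the tail of the series of inverse squares sums these
  to order \<open>N / k\<close>.
\<close>

lemma card_excess_ge:
  assumes k: "k \<ge> 1"
  shows "real (card {n\<in>{1..N}. k \<le> excess n}) \<le> 4 * (real N / real k)"
proof -
  define K where "K = (k + 1) div 2"
  have K: "K \<ge> 1" "k \<le> 2 * K" using k by (auto simp: K_def)
  have "{n\<in>{1..N}. k \<le> excess n} \<subseteq> (\<Union>m\<in>{K..N}. {n\<in>{1..N}. m ^ 2 dvd n})"
  proof
    fix n assume n: "n \<in> {n\<in>{1..N}. k \<le> excess n}"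
    define m where "m = square_part n"
    have "m ^ 2 dvd n" by (simp add: m_def)
    hence "m ^ 2 \<le> n" using n by (auto intro: dvd_imp_le)
    moreover have "m \<le> m ^ 2" by (simp add: power2_eq_square)
    moreover have "k \<le> 2 * m" using n excess_le_square_part[of n] by (simp add: m_def)
    ultimately have "m \<in> {K..N}" using n by (auto simp: K_def)
    thus "n \<in> (\<Union>m\<in>{K..N}. {n\<in>{1..N}. m ^ 2 dvd n})" using n \<open>m ^ 2 dvd n\<close> by blast
  qed
  hence "card {n\<in>{1..N}. k \<le> excess n} \<le> card (\<Union>m\<in>{K..N}. {n\<in>{1..N}. m ^ 2 dvd n})"
    by (intro card_mono) auto
  also have "\<dots> \<le> (\<Sum>m=K..N. card {n\<in>{1..N}. m ^ 2 dvd n})"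
    by (rule card_UN_le) simp
  also have "\<dots> = (\<Sum>m=K..N. N div m ^ 2)"
    using K by (intro sum.cong refl card_multiples_atMost) auto
  finally have "real (card {n\<in>{1..N}. k \<le> excess n}) \<le> real (\<Sum>m=K..N. N div m ^ 2)"
    by (rule of_nat_mono)
  also have "\<dots> = (\<Sum>m=K..N. real (N div m ^ 2))" by simp
  also have "\<dots> \<le> (\<Sum>m=K..N. real N * (1 / real m ^ 2))"
  proof (rule sum_mono)
    fix m
    show "real (N div m ^ 2) \<le> real N * (1 / real m ^ 2)"
      using real_div_nat_bounds(1)[of N "m ^ 2"] by simp
  qed
  also have "\<dots> = real N * (\<Sum>m=K..N. 1 / real m ^ 2)" by (simp add: sum_distrib_left)
  also have "\<dots> \<le> real N * (2 / real K)"
    by (intro mult_left_mono sum_inverse_squares_tail K) auto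
  also have "\<dots> \<le> real N * (4 / real k)"
    using K k by (intro mult_left_mono) (auto simp: field_simps)
  also have "\<dots> = 4 * (real N / real k)" by simp
  finally show ?thesis .
qed

section \<open>Mean values of functions of the excess\<close>

lemma excess_mean_value:
  obtains C where "C > 0"
    "\<And>H. (\<And>j. \<bar>H j\<bar> \<le> 1) \<Longrightarrow>
      \<exists>M. \<forall>x::real\<ge>2. \<bar>(\<Sum>n=1..nat \<lfloor>x\<rfloor>. H (excess n)) - M * x\<bar> \<le> C * (x powr (1/2) * ln x)"
proof -
  obtain C where C: "C > 0"
    "\<And>h. blind h \<Longrightarrow> (\<And>n. \<bar>h n\<bar> \<le> 1) \<Longrightarrow>
      \<exists>M. \<forall>x::real\<ge>2. \<bar>(\<Sum>n=1..nat \<lfloor>x\<rfloor>. h n) - M * x\<bar> \<le> C * (x powr (1/2) * ln x)"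
    using blind_mean_value by blast
  show ?thesis
  proof (rule that[OF C(1)])
    fix H :: "nat \<Rightarrow> real" assume "\<And>j. \<bar>H j\<bar> \<le> 1"
    moreover have "blind (\<lambda>n. H (excess n))"
      unfolding blind_def by (metis excess_mult_prime)
    ultimately show "\<exists>M. \<forall>x::real\<ge>2. \<bar>(\<Sum>n=1..nat \<lfloor>x\<rfloor>. H (excess n)) - M * x\<bar>
        \<le> C * (x powr (1/2) * ln x)"
      by (intro C(2)) auto
  qed
qed

lemma tendsto_mean:
  fixes S :: "real \<Rightarrow> real"
  assumes "\<And>x. x \<ge> 2 \<Longrightarrow> \<bar>S x - M * x\<bar> \<le> C * (x powr (1/2) * ln x)"
  shows "((\<lambda>x. S x / x) \<longlongrightarrow> M) at_top"
proof -
  have "((\<lambda>x. S x / x - M) \<longlongrightarrow> 0) at_top"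
  proof (rule Lim_null_comparison)
    show "\<forall>\<^sub>F x in at_top. norm (S x / x - M) \<le> C * (x powr (1/2) * ln x) / x"
      using eventually_ge_at_top[of 2]
    proof eventually_elim
      case (elim x)
      hence "S x / x - M = (S x - M * x) / x" by (simp add: field_simps)
      hence "norm (S x / x - M) = \<bar>S x - M * x\<bar> / x" using elim by simp
      also have "\<dots> \<le> C * (x powr (1/2) * ln x) / x"
        using elim assms[of x] by (intro divide_right_mono) auto
      finally show ?case .
    qed
    show "((\<lambda>x. C * (x powr (1/2) * ln x) / x) \<longlongrightarrow> 0) at_top" by real_asymp
  qed
  thus ?thesis by (simp add: LIM_zero_iff)
qed

lemma positive_upto_real_eq:
  assumes "x \<ge> 0"
  shows "{n::nat. 1 \<le> n \<and> real n \<le> x \<and> P n} = {n\<in>{1..nat \<lfloor>x\<rfloor>}. P n}"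
  using assms by (auto simp: le_nat_iff le_floor_iff)

lemma card_eq_sum_indicator:
  "finite A \<Longrightarrow> real (card {n\<in>A. P n}) = (\<Sum>n\<in>A. if P n then 1 else 0)"
  by (simp add: sum.inter_filter[symmetric])

theorem mainTheorem1:
  shows "\<exists>d :: nat \<Rightarrow> real.
    (\<forall>k. ((\<lambda>x::real. real (card {n::nat. 1 \<le> n \<and> real n \<le> x \<and> B_add n - beta_add n = k}) / x)
            \<longlongrightarrow> d k) at_top) \<and>
    (\<exists>C::real. \<forall>k. \<forall>x::real. 2 \<le> x \<longrightarrow>
        \<bar>real (card {n::nat. 1 \<le> n \<and> real n \<le> x \<and> B_add n - beta_add n = k}) - d k * x\<bar>
          \<le> C * (x powr (1/2) * ln x)) \<and>
    (\<exists>C::real. \<forall>k::nat. \<forall>x::real. 1 \<le> k \<longrightarrow> 2 \<le> x \<longrightarrow>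
        real (card {n::nat. 1 \<le> n \<and> real n \<le> x \<and> k \<le> B_add n - beta_add n})
          \<le> C * (x / real k)) \<and>
    (\<forall>r::real. 0 < r \<longrightarrow>
      (\<exists>D::real. (\<lambda>k. d (Suc k) / real (Suc k) powr r) sums D \<and>
        (\<exists>C::real. \<forall>x::real. 2 \<le> x \<longrightarrow>
          \<bar>(\<Sum>n | 1 \<le> n \<and> real n \<le> x \<and> \<not> squarefree n.
               1 / real (B_add n - beta_add n) powr r) - D * x\<bar>
            \<le> C * (x powr (1 - r/2) * ln x) + C * (x powr (1/2) * ln x))))"
proof -
  obtain C where C: "C > 0"
    "\<And>H. (\<And>j. \<bar>H j\<bar> \<le> 1) \<Longrightarrow>
      \<exists>M. \<forall>x::real\<ge>2. \<bar>(\<Sum>n=1..nat \<lfloor>x\<rfloor>. H (excess n)) - M * x\<bar> \<le> C * (x powr (1/2) * ln x)"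
    using excess_mean_value by blast
  define count where "count = (\<lambda>k x. real (card {n::nat. 1 \<le> n \<and> real n \<le> x \<and> excess n = k}))"
  have count_eq: "count k x = (\<Sum>n=1..nat \<lfloor>x\<rfloor>. if excess n = k then 1 else 0)"
    if "x \<ge> 2" for k x
    unfolding count_def using that by (simp only: positive_upto_real_eq card_eq_sum_indicator finite_atLeastAtMost)
  have "\<forall>k. \<exists>M. \<forall>x::real\<ge>2. \<bar>count k x - M * x\<bar> \<le> C * (x powr (1/2) * ln x)"
  proof
    fix k
    show "\<exists>M. \<forall>x::real\<ge>2. \<bar>count k x - M * x\<bar> \<le> C * (x powr (1/2) * ln x)"
      using C(2)[of "\<lambda>j. if j = k then 1 else 0"] by (simp add: count_eq)
  qed
  then obtain d where d: "\<And>k x. x \<ge> 2 \<Longrightarrow> \<bar>count k x - d k * x\<bar> \<le> C * (x powr (1/2) * ln x)"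
    by metis
  have lim: "((\<lambda>x. count k x / x) \<longlongrightarrow> d k) at_top" for k
    by (rule tendsto_mean) (rule d)
  have large: "real (card {n::nat. 1 \<le> n \<and> real n \<le> x \<and> k \<le> excess n}) \<le> 4 * (x / real k)"
    if "k \<ge> 1" "x \<ge> 2" for k x
  proof -
    have "real (card {n::nat. 1 \<le> n \<and> real n \<le> x \<and> k \<le> excess n}) \<le> 4 * (real (nat \<lfloor>x\<rfloor>) / real k)"
      using card_excess_ge[OF that(1), of "nat \<lfloor>x\<rfloor>"] that(2) by (simp only: positive_upto_real_eq)
    also have "\<dots> \<le> 4 * (x / real k)"
      using that of_nat_floor[of x] by (intro mult_left_mono divide_right_mono) auto
    finally show ?thesis .
  qed
  \<comment> \<open>The value \<open>D\<close> comes from the mean value result for \<open>1 / j powr r\<close>, so its error term is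
    uniformly of order \<open>x powr (1/2) * ln x\<close>. Summing the errors of the single densities instead
    would lose a further logarithm at \<open>r = 1\<close>.\<close>
  have moment: "\<exists>D. (\<lambda>k. d (Suc k) / real (Suc k) powr r) sums D \<and>
        (\<exists>C::real. \<forall>x::real. 2 \<le> x \<longrightarrow>
          \<bar>(\<Sum>n | 1 \<le> n \<and> real n \<le> x \<and> \<not> squarefree n. 1 / real (excess n) powr r) - D * x\<bar>
            \<le> C * (x powr (1 - r/2) * ln x) + C * (x powr (1/2) * ln x))"
    if r: "r > 0" for r
  proof -
    define H where "H = (\<lambda>j. 1 / real j powr r)"
    \<comment> \<open>The value at \<open>0\<close> is \<open>1 / 0 = 0\<close>, so squarefree numbers contribute nothing and the sum may
      run over all \<open>n\<close>.\<close>
    have H0: "H 0 = 0" by (simp add: H_def)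
    have H1: "\<bar>H j\<bar> \<le> 1" for j
      using r ge_one_powr_ge_zero[of "real j" r] by (cases "j = 0") (auto simp: H_def field_simps)
    define S where "S = (\<lambda>x::real. \<Sum>n=1..nat \<lfloor>x\<rfloor>. H (excess n))"
    obtain D where D: "\<And>x. x \<ge> 2 \<Longrightarrow> \<bar>S x - D * x\<bar> \<le> C * (x powr (1/2) * ln x)"
      using C(2)[of H] H1 unfolding S_def by blast
    have limS: "((\<lambda>x. S x / x) \<longlongrightarrow> D) at_top" by (rule tendsto_mean) (rule D)
    have S_eq: "(\<Sum>n | 1 \<le> n \<and> real n \<le> x \<and> \<not> squarefree n. 1 / real (excess n) powr r) = S x"
      if "x \<ge> 2" for x
    proof -
      have "(\<Sum>n | 1 \<le> n \<and> real n \<le> x \<and> \<not> squarefree n. H (excess n))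
          = (\<Sum>n | n \<in> {1..nat \<lfloor>x\<rfloor>} \<and> \<not> squarefree n. H (excess n))"
        using that by (simp only: positive_upto_real_eq)
      also have "\<dots> = S x" unfolding S_def
        by (rule sum.mono_neutral_left) (auto simp: excess_squarefree H0)
      finally show ?thesis by (simp add: H_def)
    qed
    \<comment> \<open>Cutting the values of the excess at \<open>K\<close> changes the sum by at most the number of \<open>n\<close> with
      excess above \<open>K\<close>. Divided by \<open>x\<close> this is \<open>O(1 / K)\<close> uniformly in \<open>x\<close>, which
      allows the limits in \<open>x\<close> and \<open>K\<close> to be interchanged.\<close>
    have trunc: "\<bar>S x - (\<Sum>k<K. H (Suc k) * count (Suc k) x)\<bar> \<le> 4 * (x / real (Suc K))"
      if "x \<ge> 2" for x K
    proof -
      have split: "H j - (\<Sum>k<K. H (Suc k) * (if j = Suc k then 1 else 0)) = (if Suc K \<le> j then H j else 0)" for j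
      proof (cases j)
        case (Suc i)
        have "(\<Sum>k<K. H (Suc k) * (if j = Suc k then 1 else 0)) = (\<Sum>k<K. if i = k then H (Suc k) else 0)"
          by (rule sum.cong) (auto simp: Suc)
        thus ?thesis by (auto simp: Suc)
      qed (simp add: H0)
      have "(\<Sum>k<K. H (Suc k) * count (Suc k) x)
          = (\<Sum>k<K. \<Sum>n=1..nat \<lfloor>x\<rfloor>. H (Suc k) * (if excess n = Suc k then 1 else 0))"
        by (simp only: count_eq[OF that] sum_distrib_left)
      also have "\<dots> = (\<Sum>n=1..nat \<lfloor>x\<rfloor>. \<Sum>k<K. H (Suc k) * (if excess n = Suc k then 1 else 0))"
        by (rule sum.swap)
      finally have "S x - (\<Sum>k<K. H (Suc k) * count (Suc k) x)
          = (\<Sum>n=1..nat \<lfloor>x\<rfloor>. if Suc K \<le> excess n then H (excess n) else 0)"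
        by (simp only: S_def sum_subtractf[symmetric] split)
      also have "\<bar>\<dots>\<bar> \<le> (\<Sum>n=1..nat \<lfloor>x\<rfloor>. \<bar>if Suc K \<le> excess n then H (excess n) else 0\<bar>)"
        by (rule sum_abs)
      also have "\<dots> \<le> (\<Sum>n=1..nat \<lfloor>x\<rfloor>. if Suc K \<le> excess n then 1 else 0)"
        by (intro sum_mono) (use H1 in auto)
      also have "\<dots> = real (card {n::nat. 1 \<le> n \<and> real n \<le> x \<and> Suc K \<le> excess n})"
        using that by (simp only: positive_upto_real_eq card_eq_sum_indicator finite_atLeastAtMost)
      also have "\<dots> \<le> 4 * (x / real (Suc K))" by (rule large) (use that in auto)
      finally show ?thesis .
    qed
    have close: "\<bar>D - (\<Sum>k<K. H (Suc k) * d (Suc k))\<bar> \<le> 4 / real (Suc K)" for K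
    proof (rule tendsto_upperbound)
      show "((\<lambda>x. \<bar>S x / x - (\<Sum>k<K. H (Suc k) * (count (Suc k) x / x))\<bar>)
          \<longlongrightarrow> \<bar>D - (\<Sum>k<K. H (Suc k) * d (Suc k))\<bar>) at_top"
        by (intro tendsto_intros limS lim)
      show "\<forall>\<^sub>F x in at_top. \<bar>S x / x - (\<Sum>k<K. H (Suc k) * (count (Suc k) x / x))\<bar> \<le> 4 / real (Suc K)"
        using eventually_ge_at_top[of 2]
      proof eventually_elim
        case (elim x)
        have "S x / x - (\<Sum>k<K. H (Suc k) * (count (Suc k) x / x))
            = (S x - (\<Sum>k<K. H (Suc k) * count (Suc k) x)) / x"
          by (simp add: sum_divide_distrib diff_divide_distrib)
        hence "\<bar>S x / x - (\<Sum>k<K. H (Suc k) * (count (Suc k) x / x))\<bar>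
            = \<bar>S x - (\<Sum>k<K. H (Suc k) * count (Suc k) x)\<bar> / x" using elim by simp
        also have "\<dots> \<le> 4 * (x / real (Suc K)) / x"
          using trunc[OF elim, of K] elim by (intro divide_right_mono) auto
        also have "\<dots> = 4 / real (Suc K)" using elim by simp
        finally show ?case .
      qed
    qed simp
    have "(\<lambda>K. D - (\<Sum>k<K. H (Suc k) * d (Suc k))) \<longlonglongrightarrow> 0"
    proof (rule Lim_null_comparison)
      show "\<forall>\<^sub>F K in sequentially. norm (D - (\<Sum>k<K. H (Suc k) * d (Suc k))) \<le> 4 / real (Suc K)"
        using close by (intro always_eventually) simp
      show "(\<lambda>K. 4 / real (Suc K)) \<longlonglongrightarrow> 0" by real_asymp
    qed
    from tendsto_diff[OF tendsto_const[of D] this]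
    have "(\<lambda>k. H (Suc k) * d (Suc k)) sums D" by (simp add: sums_def)
    hence "(\<lambda>k. d (Suc k) / real (Suc k) powr r) sums D" by (simp add: H_def)
    moreover have "\<bar>(\<Sum>n | 1 \<le> n \<and> real n \<le> x \<and> \<not> squarefree n. 1 / real (excess n) powr r) - D * x\<bar>
            \<le> C * (x powr (1 - r/2) * ln x) + C * (x powr (1/2) * ln x)" if "x \<ge> 2" for x
    proof -
      have "0 \<le> C * (x powr (1 - r/2) * ln x)" using C(1) that by simp
      thus ?thesis using D[OF that] S_eq[OF that] by linarith
    qed
    ultimately show ?thesis by blast
  qed
  have count: "real (card {n::nat. 1 \<le> n \<and> real n \<le> x \<and> excess n = k}) = count k x" for k x
    by (simp add: count_def)
  show ?thesis unfolding excess_def[symmetric] count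
  proof (rule exI[of _ d], intro conjI allI impI)
    show "((\<lambda>x. count k x / x) \<longlongrightarrow> d k) at_top" for k by (rule lim)
    show "\<exists>C. \<forall>k x. 2 \<le> x \<longrightarrow> \<bar>count k x - d k * x\<bar> \<le> C * (x powr (1/2) * ln x)"
      using d by blast
    show "\<exists>C. \<forall>k x. 1 \<le> k \<longrightarrow> 2 \<le> x \<longrightarrow>
        real (card {n::nat. 1 \<le> n \<and> real n \<le> x \<and> k \<le> excess n}) \<le> C * (x / real k)"
      using large by blast
  qed (rule moment)
qed

end
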